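(* Let $\{S_n\}_{n\ge 0}$ be either (a) simple random walk, started at a fixed vertex $e$, on a countably infinite, connected, vertex transitive graph $\mathcal G$ all of whose vertices have the same finite degree $\mathcal D$; or (b) the right random walk $S_n = X_1X_2\cdots X_n$ ($S_0=e$ the identity) on a Cayley graph $(G,\mathcal S)$ of an infinite group $G$ generated by a finite set $\mathcal S=\{g_1,\dots,g_s,g_1^{-1},\dots,g_s^{-1}\}$, where the step weights satisfy $\alpha_i=\alpha_{s+i}$ for $1\le i\le s$ and $\alpha_i>0$ for all $i$. Assume that $$\limsup_{n\to\infty}\,[u_{2n}]^{1/n}=1 .$$ Then for all $\varepsilon>0$ $$\lim_{n\to\infty,\; p\mid n} P\Big\{\tfrac1n R_n>1-F+\varepsilon\,\Big|\,\mathcal E_n\Big\}=0 .$$ In particular, if $\{S_n\}$ is recurrent, then $\frac1n R_n$ conditioned on $\mathcal E_n$ tends to $0$ in probability as $n\to\infty$ through multiples of $p$ (that is, $P\{\frac1n R_n>\varepsilon\mid\mathcal E_n\}\to0$ for every $\varepsilon>0$ as $n\to\infty$ with $p\mid n$).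
   Context: A countable graph is vertex transitive if for any two vertices $v',v''$ there is a graph automorphism mapping $v'$ to $v''$. Simple random walk on $\mathcal G$ is the Markov chain with $P\{S_{n+1}=w\mid S_n=v\}=1/\mathcal D$ if $w$ is a neighbor of $v$ and $0$ otherwise. Cayley graph $(G,\mathcal S)$: vertices are the elements of $G$, with an edge between $v'$ and $v''$ iff $v''=v'g_i$ or $v''=v'g_i^{-1}$ for some $1\le i\le s$. Random walk on $(G,\mathcal S)$: given $\alpha_i\ge0$, $1\le i\le 2s$, with $\sum_{i=1}^{2s}\alpha_i=1$, let $X,X_1,X_2,\dots$ be i.i.d. $G$-valued with law giving weight $\alpha_i$ to $g_i$ and $\alpha_{s+i}$ to $g_i^{-1}$ ($1\le i\le s$; weights of coinciding elements are added), and $S_n=X_1\cdots X_n$. Thus $P\{S_{n+1}=w\mid S_n=v\}=\sum_{i:\,vg_i=w}\alpha_i+\sum_{i:\,vg_i^{-1}=w}\alpha_{s+i}$. Notation: $\mathcal E_n=\{S_n=e\}$; $u_n=P\{\mathcal E_n\}$; $f_n=P\{S_k\ne e \text{ for } 1\le k\le n-1,\ S_n=e\}$ for $n\ge1$; $F=\sum_{n=1}^\infty f_n$ (the probability of ever returning to $e$); $R_n=|\{S_0,S_1,\dots,S_{n-1}\}|$ (the range). The period is $p=\gcd\{n\ge1:u_n>0\}$, which is $1$ or $2$. The notation $\lim_{n\to\infty,\,p\mid n}$ means the limit along multiples $n$ of $p$ (for which $u_n>0$ once $n$ is large). *)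

theory Defs
  imports "HOL-Probability.Probability" "HOL-Algebra.Generated_Groups"
begin

section \<open>Simple random walk on a vertex transitive graph\<close>

definition graph_automorphism :: "'a set \<Rightarrow> ('a \<times> 'a) set \<Rightarrow> ('a \<Rightarrow> 'a) \<Rightarrow> bool" where
  "graph_automorphism V E \<phi> \<longleftrightarrow>
     bij_betw \<phi> V V \<and> (\<forall>v\<in>V. \<forall>w\<in>V. (\<phi> v, \<phi> w) \<in> E \<longleftrightarrow> (v, w) \<in> E)"

text \<open>An undirected edge between \<open>v\<close> and \<open>w\<close> is represented by the two pairs \<open>(v, w)\<close> and
  \<open>(w, v)\<close>, so \<open>E `` {v}\<close> is the set of neighbors of \<open>v\<close>.  Irreflexivity is not required:
  loops are allowed, as they are in a Cayley graph having the identity among its generators; a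
  looped vertex is its own neighbor and the loop counts once in the degree.\<close>

locale vertex_transitive_graph =
  fixes V :: "'a set" and E :: "('a \<times> 'a) set" and D :: nat
  assumes edges: "E \<subseteq> V \<times> V" "sym E"
    and countably_infinite: "countable V" "infinite V"
    and connected: "\<And>v w. v \<in> V \<Longrightarrow> w \<in> V \<Longrightarrow> (v, w) \<in> E\<^sup>*"
    and transitive: "\<And>v w. v \<in> V \<Longrightarrow> w \<in> V \<Longrightarrow> \<exists>\<phi>. graph_automorphism V E \<phi> \<and> \<phi> v = w"
    and degree: "\<And>v. v \<in> V \<Longrightarrow> finite (E `` {v})" "\<And>v. v \<in> V \<Longrightarrow> card (E `` {v}) = D"

locale simple_random_walk =
  prob_space M + vertex_transitive_graph V E D
  for M :: "'w measure" and V :: "'a set" and E :: "('a \<times> 'a) set" and D :: nat +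
  fixes e :: 'a and S :: "nat \<Rightarrow> 'w \<Rightarrow> 'a"
  assumes start_in: "e \<in> V"
    and rv: "\<And>n. S n \<in> measurable M (count_space V)"
    and start: "AE \<omega> in M. S 0 \<omega> = e"
    and markov: "\<And>n x w. w \<in> V \<Longrightarrow> \<P>(\<omega> in M. \<forall>i\<le>n. S i \<omega> = x i) > 0 \<Longrightarrow>
      \<P>(\<omega> in M. S (Suc n) \<omega> = w \<bar> \<forall>i\<le>n. S i \<omega> = x i) = (if (x n, w) \<in> E then 1 / real D else 0)"

section \<open>Symmetric right random walk on a finitely generated group\<close>

text \<open>The family \<open>g\<close> may have repetitions, and may contain involutions or the identity; the law
  of a step adds up the weights of all indices that yield the same element.\<close>

locale group_random_walk =
  prob_space M + group G
  for M :: "'w measure" and G :: "('a, 'b) monoid_scheme" (structure) +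
  fixes s :: nat and g :: "nat \<Rightarrow> 'a" and \<alpha> :: "nat \<Rightarrow> real"
    and X :: "nat \<Rightarrow> 'w \<Rightarrow> 'a" and S :: "nat \<Rightarrow> 'w \<Rightarrow> 'a"
  assumes infinite_group: "infinite (carrier G)"
    and generators: "g ` {1..s} \<subseteq> carrier G"
      "generate G (g ` {1..s} \<union> (\<lambda>i. inv (g i)) ` {1..s}) = carrier G"
    and weights: "\<And>i. i \<in> {1..2 * s} \<Longrightarrow> \<alpha> i > 0" "(\<Sum>i=1..2 * s. \<alpha> i) = 1"
      "\<And>i. i \<in> {1..s} \<Longrightarrow> \<alpha> i = \<alpha> (s + i)"
    and indep: "indep_vars (\<lambda>_. count_space (carrier G)) X {1..}"
    and step_law: "\<And>k x. k \<ge> 1 \<Longrightarrow> x \<in> carrier G \<Longrightarrow>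
      \<P>(\<omega> in M. X k \<omega> = x) =
        (\<Sum>i\<in>{i\<in>{1..s}. g i = x}. \<alpha> i) + (\<Sum>i\<in>{i\<in>{1..s}. inv (g i) = x}. \<alpha> (s + i))"
    and walk_0: "\<And>\<omega>. \<omega> \<in> space M \<Longrightarrow> S 0 \<omega> = \<one>"
    and walk_Suc: "\<And>n \<omega>. \<omega> \<in> space M \<Longrightarrow> S (Suc n) \<omega> = S n \<omega> \<otimes> X (Suc n) \<omega>"

section \<open>Return probabilities, period and range\<close>

definition return_prob :: "'w measure \<Rightarrow> (nat \<Rightarrow> 'w \<Rightarrow> 'a) \<Rightarrow> 'a \<Rightarrow> nat \<Rightarrow> real" where
  "return_prob M S e n = \<P>(\<omega> in M. S n \<omega> = e)"

text \<open>Only meaningful for \<open>n \<ge> 1\<close>.\<close>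
definition first_return_prob :: "'w measure \<Rightarrow> (nat \<Rightarrow> 'w \<Rightarrow> 'a) \<Rightarrow> 'a \<Rightarrow> nat \<Rightarrow> real" where
  "first_return_prob M S e n = \<P>(\<omega> in M. (\<forall>k\<in>{1..<n}. S k \<omega> \<noteq> e) \<and> S n \<omega> = e)"

definition total_return_prob :: "'w measure \<Rightarrow> (nat \<Rightarrow> 'w \<Rightarrow> 'a) \<Rightarrow> 'a \<Rightarrow> real" where
  "total_return_prob M S e = (\<Sum>n. first_return_prob M S e (Suc n))"

definition recurrent :: "'w measure \<Rightarrow> (nat \<Rightarrow> 'w \<Rightarrow> 'a) \<Rightarrow> 'a \<Rightarrow> bool" where
  "recurrent M S e \<longleftrightarrow> (AE \<omega> in M. \<exists>n\<ge>1. S n \<omega> = e)"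

definition period :: "'w measure \<Rightarrow> (nat \<Rightarrow> 'w \<Rightarrow> 'a) \<Rightarrow> 'a \<Rightarrow> nat" where
  "period M S e = Gcd {n. n \<ge> 1 \<and> return_prob M S e n > 0}"

definition walk_range :: "(nat \<Rightarrow> 'w \<Rightarrow> 'a) \<Rightarrow> nat \<Rightarrow> 'w \<Rightarrow> nat" where
  "walk_range S n \<omega> = card ((\<lambda>k. S k \<omega>) ` {..<n})"

definition multiples_at_top :: "nat \<Rightarrow> nat filter" where
  "multiples_at_top p = inf at_top (principal {n. p dvd n})"

end

theory Submission
  imports Defs
begin

text \<open>
  The conditioning event has probability \<open>u\<^sub>n\<close>, which decays subexponentially, whereas a range that
  exceeds its typical size \<open>(1 - F) n\<close> by a fixed proportion has exponentially small probability
  already for the unconditioned walk.  Dividing the second probability by the first gives the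
  theorem, with no need to describe the conditioned walk.

  \<^emph>\<open>Upper large deviations of the range.\<close>  The range is subadditive along the path:
  \<open>R\<^sub>m\<^sub>+\<^sub>n\<close> is at most \<open>R\<^sub>m\<close> plus the range of the next \<open>n\<close> steps.  By the Markov property and
  homogeneity that second range has the law of \<open>R\<^sub>n\<close> whatever the current position, so
  \<open>E[exp (t R\<^sub>n)]\<close> is submultiplicative in \<open>n\<close> (\<open>range_mgf_submult\<close>).  It thus suffices to bound it for
  one fixed block length \<open>L\<close>, and there convexity of \<open>exp\<close> reduces it to the mean \<open>E[R\<^sub>L]\<close>
  (\<open>range_mgf_le_mean_range\<close>).  Comparing the walk with the walk after its first step gives
  \<open>E[R\<^sub>n\<^sub>+\<^sub>1] = E[R\<^sub>n] + P{no return to the start in n steps}\<close> (\<open>mean_range_Suc\<close>); as these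
  probabilities decrease to \<open>1 - F\<close>, \<open>E[R\<^sub>L] / L\<close> comes as close to \<open>1 - F\<close> as desired.  Markov's
  inequality then yields \<open>range_large_deviation\<close>.

  \<^emph>\<open>Subexponential return probabilities.\<close>  The sequence \<open>u\<close> is supermultiplicative, and \<open>u\<^sub>2 > 0\<close>
  because steps can be reversed.  A single index \<open>m\<close> at which \<open>u\<^sub>2\<^sub>m\<close> is close to \<open>1\<close> on the
  exponential scale therefore controls all large multiples of the period
  (\<open>supermultiplicative_subexponential\<close>).

  Both walks of the theorem are Markov chains with finitely supported, symmetric transition
  probabilities that are invariant under a transitive group of bijections; everything above is
  proved for such chains.  In the recurrent case \<open>F = 1\<close>, and the second claim is the first one.
\<close>

section \<open>Expectations under finitely supported distributions\<close>

lemma expectation_bind_pmf_finite: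
  fixes h :: "'b \<Rightarrow> real"
  assumes fin: "finite (set_pmf p)" "\<And>x. x \<in> set_pmf p \<Longrightarrow> finite (set_pmf (f x))"
    and nonneg: "\<And>y. h y \<ge> 0"
  shows "measure_pmf.expectation (bind_pmf p f) h =
    measure_pmf.expectation p (\<lambda>x. measure_pmf.expectation (f x) h)"
proof -
  have fin_bind: "finite (set_pmf (bind_pmf p f))"
    using fin by auto
  have "ennreal (measure_pmf.expectation (bind_pmf p f) h) = (\<integral>\<^sup>+y. h y \<partial>bind_pmf p f)"
    using fin_bind nonneg
    by (intro nn_integral_eq_integral[symmetric] integrable_measure_pmf_finite) auto
  also have "\<dots> = (\<integral>\<^sup>+x. \<integral>\<^sup>+y. h y \<partial>f x \<partial>p)"
    by simp
  also have "\<dots> = (\<integral>\<^sup>+x. ennreal (measure_pmf.expectation (f x) h) \<partial>p)"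
    using fin nonneg
    by (intro nn_integral_cong_AE AE_pmfI nn_integral_eq_integral integrable_measure_pmf_finite) auto
  also have "\<dots> = ennreal (measure_pmf.expectation p (\<lambda>x. measure_pmf.expectation (f x) h))"
    using fin nonneg
    by (intro nn_integral_eq_integral integrable_measure_pmf_finite) auto
  finally show ?thesis
    using nonneg by simp
qed

lemma expectation_mono_pmf_finite:
  fixes f h :: "'b \<Rightarrow> real"
  assumes "finite (set_pmf p)" "\<And>x. x \<in> set_pmf p \<Longrightarrow> f x \<le> h x"
  shows "measure_pmf.expectation p f \<le> measure_pmf.expectation p h"
  using assms by (intro integral_mono_AE integrable_measure_pmf_finite AE_pmfI) auto

lemma expectation_cong_pmf:
  fixes f h :: "'b \<Rightarrow> real"
  assumes "\<And>x. x \<in> set_pmf p \<Longrightarrow> f x = h x"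
  shows "measure_pmf.expectation p f = measure_pmf.expectation p h"
  using assms by (intro integral_cong_AE AE_pmfI) auto

section \<open>Walks driven by a homogeneous kernel\<close>

text \<open>The bijection \<open>\<phi>\<close> is a graph automorphism for a vertex transitive graph and a left translation
  for a group.\<close>
locale homogeneous_kernel =
  fixes V :: "'a set" and K :: "'a \<Rightarrow> 'a pmf"
  assumes kernel_closed: "v \<in> V \<Longrightarrow> set_pmf (K v) \<subseteq> V"
    and kernel_finite: "v \<in> V \<Longrightarrow> finite (set_pmf (K v))"
    and kernel_symmetric: "v \<in> V \<Longrightarrow> w \<in> V \<Longrightarrow> pmf (K v) w = pmf (K w) v"
    and kernel_homogeneous: "v \<in> V \<Longrightarrow> w \<in> V \<Longrightarrow>
      \<exists>\<phi>. bij_betw \<phi> V V \<and> \<phi> v = w \<and> (\<forall>u\<in>V. K (\<phi> u) = map_pmf \<phi> (K u))"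
begin

text \<open>The joint law of the first \<open>n\<close> positions \<open>S\<^sub>0, \<dots>, S\<^sub>n\<^sub>-\<^sub>1\<close> and of \<open>S\<^sub>n\<close>, for the walk started at
  \<open>v\<close>.  Keeping \<open>S\<^sub>n\<close> apart from the list fits both uses: the list carries exactly the range \<open>R\<^sub>n\<close>,
  and \<open>S\<^sub>n\<close> is the state from which the walk restarts.\<close>
primrec walk :: "nat \<Rightarrow> 'a \<Rightarrow> ('a list \<times> 'a) pmf" where
  "walk 0 v = return_pmf ([], v)"
| "walk (Suc n) v = bind_pmf (K v) (\<lambda>w. map_pmf (\<lambda>(xs, y). (v # xs, y)) (walk n w))"

lemma set_pmf_walk:
  "v \<in> V \<Longrightarrow> finite (set_pmf (walk n v)) \<and>
    set_pmf (walk n v) \<subseteq> {xs. length xs = n \<and> set xs \<subseteq> V} \<times> V"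
proof (induction n arbitrary: v)
  case (Suc n)
  have "w \<in> V" if "w \<in> set_pmf (K v)" for w
    using that kernel_closed Suc.prems by blast
  with Suc kernel_finite[OF Suc.prems] show ?case
    by (fastforce simp: case_prod_unfold)
qed auto

lemma finite_walk: "v \<in> V \<Longrightarrow> finite (set_pmf (walk n v))"
  using set_pmf_walk by blast

lemma walk_supportD:
  assumes "v \<in> V" "r \<in> set_pmf (walk n v)"
  shows "length (fst r) = n" "set (fst r) \<subseteq> V" "snd r \<in> V"
  using subsetD[OF conjunct2[OF set_pmf_walk[OF assms(1), of n]] assms(2)] by auto

text \<open>The Markov property: after \<open>m\<close> steps the walk continues afresh from its current state.\<close>
lemma walk_add:
  "walk (m + n) v =
    bind_pmf (walk m v) (\<lambda>(xs, y). map_pmf (\<lambda>(ys, z). (xs @ ys, z)) (walk n y))"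
  by (induction m arbitrary: v)
    (simp_all add: bind_return_pmf map_bind_pmf bind_map_pmf bind_assoc_pmf
      pmf.map_comp o_def case_prod_unfold pmf.map_ident)

lemma expectation_walk_add:
  assumes "v \<in> V" "\<And>r. h r \<ge> (0::real)"
  shows "measure_pmf.expectation (walk (m + n) v) h =
    measure_pmf.expectation (walk m v)
      (\<lambda>r. measure_pmf.expectation (walk n (snd r)) (\<lambda>r'. h (fst r @ fst r', snd r')))"
  unfolding walk_add
  by (subst expectation_bind_pmf_finite)
    (use assms in \<open>auto intro!: finite_walk dest: walk_supportD simp: case_prod_unfold\<close>)

text \<open>The defining recursion splits off the first step; a stochastic process is specified by its
  next step given the past, so the recursion at the other end is what identifies its law.\<close>
lemma pmf_walk_Suc_snoc:
  "pmf (walk (Suc n) v) (xs @ [y], z) = pmf (walk n v) (xs, y) * pmf (K y) z"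
proof -
  have one: "walk 1 y' = map_pmf (\<lambda>z. ([y'], z)) (K y')" for y'
    by (simp add: map_pmf_def bind_return_pmf)
  have "walk (n + 1) v = bind_pmf (walk n v) (\<lambda>(us, y'). map_pmf (\<lambda>z. (us @ [y'], z)) (K y'))"
    unfolding walk_add one by (simp add: pmf.map_comp o_def case_prod_unfold)
  then have "pmf (walk (Suc n) v) (xs @ [y], z) =
      pmf (bind_pmf (walk n v) (\<lambda>(us, y'). map_pmf (\<lambda>z. (us @ [y'], z)) (K y'))) (xs @ [y], z)"
    by (simp del: walk.simps(2))
  also have "\<dots> = measure_pmf.expectation (walk n v)
      (\<lambda>r. indicator {(xs, y)} r * pmf (K y) z)"
    unfolding pmf_bind
  proof (rule expectation_cong_pmf)
    fix r
    show "pmf (case r of (us, y') \<Rightarrow> map_pmf (\<lambda>z. (us @ [y'], z)) (K y')) (xs @ [y], z) =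
        indicator {(xs, y)} r * pmf (K y) z"
    proof (cases "r = (xs, y)")
      case True
      then show ?thesis
        by (simp add: pmf_map_inj' inj_def)
    next
      case False
      then show ?thesis
        by (cases r) (auto simp: pmf_map_outside image_iff)
    qed
  qed
  also have "\<dots> = pmf (walk n v) (xs, y) * pmf (K y) z"
    by (simp add: measure_pmf_single)
  finally show ?thesis .
qed

lemma walk_automorphism:
  assumes "\<And>u. u \<in> V \<Longrightarrow> K (\<phi> u) = map_pmf \<phi> (K u)" and "v \<in> V"
  shows "walk n (\<phi> v) = map_pmf (\<lambda>r. (map \<phi> (fst r), \<phi> (snd r))) (walk n v)"
  using assms(2)
proof (induction n arbitrary: v)
  case (Suc n)
  have "walk (Suc n) (\<phi> v) =
      bind_pmf (K v) (\<lambda>w. map_pmf (\<lambda>(xs, y). (\<phi> v # xs, y)) (walk n (\<phi> w)))"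
    by (simp add: assms(1)[OF Suc.prems] bind_map_pmf)
  also have "\<dots> = bind_pmf (K v) (\<lambda>w. map_pmf (\<lambda>(xs, y). (\<phi> v # xs, y))
      (map_pmf (\<lambda>r. (map \<phi> (fst r), \<phi> (snd r))) (walk n w)))"
    using Suc.IH kernel_closed[OF Suc.prems] by (intro bind_pmf_cong refl) (auto simp: subset_iff)
  finally show ?case
    by (simp add: map_bind_pmf pmf.map_comp o_def case_prod_unfold)
qed simp

text \<open>A statistic of the path that survives every injective relabelling of the states, such as the
  number of distinct ones, has the same mean for all starting points.\<close>
lemma expectation_walk_homogeneous:
  fixes h :: "'a list \<times> 'a \<Rightarrow> real"
  assumes "v \<in> V" "w \<in> V"
    and "\<And>\<phi> xs y. inj_on \<phi> V \<Longrightarrow> length xs = n \<Longrightarrow> set xs \<subseteq> V \<Longrightarrow> y \<in> V \<Longrightarrow> h (map \<phi> xs, \<phi> y) = h (xs, y)"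
  shows "measure_pmf.expectation (walk n v) h = measure_pmf.expectation (walk n w) h"
proof -
  obtain \<phi> where \<phi>: "bij_betw \<phi> V V" "\<phi> v = w" "\<forall>u\<in>V. K (\<phi> u) = map_pmf \<phi> (K u)"
    using kernel_homogeneous assms(1,2) by blast
  have "measure_pmf.expectation (walk n w) h =
      measure_pmf.expectation (walk n v) (\<lambda>r. h (map \<phi> (fst r), \<phi> (snd r)))"
    using walk_automorphism[of \<phi> v n] \<phi> assms(1) by simp
  also have "\<dots> = measure_pmf.expectation (walk n v) h"
  proof (rule expectation_cong_pmf)
    fix r assume "r \<in> set_pmf (walk n v)"
    then show "h (map \<phi> (fst r), \<phi> (snd r)) = h r"
      using assms(3)[OF bij_betw_imp_inj_on[OF \<phi>(1)], of "fst r" "snd r"]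
        walk_supportD[OF assms(1), of r n] by simp
  qed
  finally show ?thesis by simp
qed

definition return_probability :: "nat \<Rightarrow> 'a \<Rightarrow> real" where
  "return_probability n v = measure_pmf.expectation (walk n v) (\<lambda>r. of_bool (snd r = v))"

text \<open>The list of \<open>walk (Suc n) v\<close> holds the times \<open>0, \<dots>, n\<close>; dropping its head \<open>v\<close> leaves the times
  \<open>1, \<dots>, n\<close>.\<close>
definition no_return_probability :: "nat \<Rightarrow> 'a \<Rightarrow> real" where
  "no_return_probability n v =
    measure_pmf.expectation (walk (Suc n) v) (\<lambda>r. of_bool (v \<notin> set (tl (fst r))))"

definition mean_range :: "nat \<Rightarrow> 'a \<Rightarrow> real" where
  "mean_range n v = measure_pmf.expectation (walk n v) (\<lambda>r. real (card (set (fst r))))"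

definition range_mgf :: "real \<Rightarrow> nat \<Rightarrow> 'a \<Rightarrow> real" where
  "range_mgf t n v = measure_pmf.expectation (walk n v) (\<lambda>r. exp (t * real (card (set (fst r)))))"

lemma return_probability_eq_prob:
  "return_probability n v = measure_pmf.prob (walk n v) {r. snd r = v}"
proof -
  have "(\<lambda>r. of_bool (snd r = v)) = (indicator {r. snd r = v} :: 'a list \<times> 'a \<Rightarrow> real)"
    by (auto simp: fun_eq_iff)
  then show ?thesis
    by (simp add: return_probability_def)
qed

text \<open>One way to be back after \<open>m + n\<close> steps is to be back already after \<open>m\<close> steps.\<close>
lemma return_probability_supermult:
  assumes "v \<in> V"
  shows "return_probability m v * return_probability n v \<le> return_probability (m + n) v"
proof -
  have "return_probability m v * return_probability n v =
      measure_pmf.expectation (walk m v) (\<lambda>r. of_bool (snd r = v) * return_probability n v)"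
    by (simp add: return_probability_def)
  also have "\<dots> \<le> measure_pmf.expectation (walk m v) (\<lambda>r.
      measure_pmf.expectation (walk n (snd r)) (\<lambda>r'. of_bool (snd r' = v)))"
    using assms
    by (intro expectation_mono_pmf_finite finite_walk)
      (auto simp: return_probability_def intro!: integral_nonneg)
  also have "\<dots> = return_probability (m + n) v"
    using assms unfolding return_probability_def by (subst expectation_walk_add) auto
  finally show ?thesis .
qed

text \<open>Take any possible step and reverse it, which symmetry of the kernel permits.\<close>
lemma return_probability_2_pos:
  assumes "v \<in> V"
  shows "return_probability 2 v > 0"
proof -
  obtain w where w: "w \<in> set_pmf (K v)"
    using set_pmf_not_empty by fast
  have "w \<in> V"
    using w kernel_closed assms by blast
  have "pmf (K v) w > 0"
    using w by (rule pmf_positive)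
  moreover from this have "pmf (K w) v > 0"
    using kernel_symmetric[OF assms \<open>w \<in> V\<close>] by simp
  ultimately have "0 < pmf (walk (Suc (Suc 0)) v) ([] @ [v] @ [w], v)"
    using pmf_walk_Suc_snoc[of "Suc 0" v "[v]" w v] pmf_walk_Suc_snoc[of 0 v "[]" v w]
    by (simp del: walk.simps(2))
  also have "\<dots> = measure_pmf.prob (walk 2 v) {([v, w], v)}"
    by (simp add: measure_pmf_single numeral_2_eq_2)
  also have "\<dots> \<le> return_probability 2 v"
    unfolding return_probability_eq_prob by (intro measure_pmf.finite_measure_mono) auto
  finally show ?thesis .
qed

lemma range_mgf_homogeneous:
  "v \<in> V \<Longrightarrow> w \<in> V \<Longrightarrow> range_mgf t n v = range_mgf t n w"
  unfolding range_mgf_def by (rule expectation_walk_homogeneous) (simp_all add: card_image inj_on_subset)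

lemma mean_range_homogeneous:
  "v \<in> V \<Longrightarrow> w \<in> V \<Longrightarrow> mean_range n v = mean_range n w"
  unfolding mean_range_def by (rule expectation_walk_homogeneous) (simp_all add: card_image inj_on_subset)

lemma range_mgf_nonneg: "range_mgf t n v \<ge> 0"
  unfolding range_mgf_def by (rule Bochner_Integration.integral_nonneg) simp

text \<open>The states visited in \<open>m + n\<close> steps are those of the first \<open>m\<close> steps together with those of the
  last \<open>n\<close>.  Given the first part, the exponential moment of the second one is a constant, by
  homogeneity, and factors out.\<close>
lemma range_mgf_submult:
  assumes "v \<in> V" "t \<ge> 0"
  shows "range_mgf t (m + n) v \<le> range_mgf t m v * range_mgf t n v"
proof -
  have "range_mgf t (m + n) v = measure_pmf.expectation (walk m v) (\<lambda>r.
      measure_pmf.expectation (walk n (snd r))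
        (\<lambda>r'. exp (t * real (card (set (fst r @ fst r'))))))"
    using assms unfolding range_mgf_def by (subst expectation_walk_add) auto
  also have "\<dots> \<le> measure_pmf.expectation (walk m v) (\<lambda>r.
      measure_pmf.expectation (walk n (snd r))
        (\<lambda>r'. exp (t * real (card (set (fst r)))) * exp (t * real (card (set (fst r'))))))"
  proof (intro expectation_mono_pmf_finite finite_walk assms)
    fix r r' :: "'a list \<times> 'a"
    have "real (card (set (fst r @ fst r'))) \<le> real (card (set (fst r))) + real (card (set (fst r')))"
      using card_Un_le[of "set (fst r)" "set (fst r')"] by simp
    then show "exp (t * real (card (set (fst r @ fst r')))) \<le>
        exp (t * real (card (set (fst r)))) * exp (t * real (card (set (fst r'))))"
      using assms(2) by (simp add: exp_add[symmetric] distrib_left[symmetric] mult_left_mono)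
  qed (use assms walk_supportD in auto)
  also have "\<dots> = measure_pmf.expectation (walk m v) (\<lambda>r.
      exp (t * real (card (set (fst r)))) * range_mgf t n (snd r))"
    by (simp add: range_mgf_def)
  also have "\<dots> = measure_pmf.expectation (walk m v) (\<lambda>r.
      exp (t * real (card (set (fst r)))) * range_mgf t n v)"
    using walk_supportD[OF assms(1)] range_mgf_homogeneous[OF _ assms(1)]
    by (intro expectation_cong_pmf) auto
  also have "\<dots> = range_mgf t m v * range_mgf t n v"
    by (simp add: range_mgf_def)
  finally show ?thesis .
qed

lemma range_mgf_mult_le_power:
  assumes "v \<in> V" "t \<ge> 0"
  shows "range_mgf t (L * k) v \<le> range_mgf t L v ^ k"
proof (induction k)
  case 0
  then show ?case by (simp add: range_mgf_def)
next
  case (Suc k)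
  have "range_mgf t (L * Suc k) v \<le> range_mgf t L v * range_mgf t (L * k) v"
    using range_mgf_submult[OF assms, of L "L * k"] by simp
  also have "\<dots> \<le> range_mgf t L v * range_mgf t L v ^ k"
    using Suc range_mgf_nonneg by (intro mult_left_mono) auto
  finally show ?case by simp
qed

lemma range_mgf_le_exp:
  assumes "v \<in> V" "t \<ge> 0"
  shows "range_mgf t n v \<le> exp (t * real n)"
proof -
  have "range_mgf t n v \<le> measure_pmf.expectation (walk n v) (\<lambda>_. exp (t * real n))"
    unfolding range_mgf_def
  proof (intro expectation_mono_pmf_finite finite_walk assms)
    fix r assume "r \<in> set_pmf (walk n v)"
    then have "card (set (fst r)) \<le> n"
      using card_length[of "fst r"] walk_supportD(1)[OF assms(1)] by auto
    then show "exp (t * real (card (set (fst r)))) \<le> exp (t * real n)"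
      using assms(2) by (simp add: mult_left_mono)
  qed
  then show ?thesis by simp
qed

text \<open>Since \<open>R\<^sub>L / L\<close> lies in \<open>[0, 1]\<close>, the convex function \<open>x \<mapsto> exp (t x)\<close> of it lies below the
  chord over that interval, and the expectation of a chord involves only the mean.\<close>
lemma range_mgf_le_mean_range:
  assumes "v \<in> V" "L > 0"
  shows "range_mgf (t / real L) L v \<le> exp ((exp t - 1) * (mean_range L v / real L))"
proof -
  have chord: "exp (t * x) \<le> 1 + (exp t - 1) * x" if "0 \<le> x" "x \<le> 1" for x :: real
    using convex_onD[OF exp_convex, of x 0 t] that
    by (simp add: algebra_simps)
  have "range_mgf (t / real L) L v \<le>
      measure_pmf.expectation (walk L v) (\<lambda>r. 1 + (exp t - 1) * (real (card (set (fst r))) / real L))"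
    unfolding range_mgf_def
  proof (intro expectation_mono_pmf_finite finite_walk assms)
    fix r assume "r \<in> set_pmf (walk L v)"
    then have "card (set (fst r)) \<le> L"
      using card_length[of "fst r"] walk_supportD(1)[OF assms(1)] by auto
    then show "exp (t / real L * real (card (set (fst r)))) \<le>
        1 + (exp t - 1) * (real (card (set (fst r))) / real L)"
      using chord[of "real (card (set (fst r))) / real L"] assms(2) by (simp add: field_simps)
  qed
  also have "\<dots> = 1 + (exp t - 1) * (mean_range L v / real L)"
    unfolding mean_range_def using finite_walk[OF assms(1)]
    by (subst Bochner_Integration.integral_add) (auto intro!: integrable_measure_pmf_finite)
  also have "\<dots> \<le> exp ((exp t - 1) * (mean_range L v / real L))"
    by (rule exp_ge_add_one_self)
  finally show ?thesis .
qed

text \<open>Deleting the starting point from the path \<open>S\<^sub>0, \<dots>, S\<^sub>n\<close> lowers the number of distinct states by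
  one if the walk does not return in \<open>n\<close> steps and leaves it unchanged otherwise.  What remains is a
  path of \<open>n\<close> states from a neighboring start, whose mean range is the same by homogeneity.\<close>
lemma mean_range_Suc:
  assumes "v \<in> V"
  shows "mean_range (Suc n) v = mean_range n v + no_return_probability n v"
proof -
  have card_step: "real (card (set (fst r))) =
      real (card (set (tl (fst r)))) + of_bool (v \<notin> set (tl (fst r)))"
    if "r \<in> set_pmf (walk (Suc n) v)" for r
    using that by (auto simp: case_prod_unfold insert_absorb)
  have "mean_range (Suc n) v = measure_pmf.expectation (walk (Suc n) v)
      (\<lambda>r. real (card (set (tl (fst r)))) + of_bool (v \<notin> set (tl (fst r))))"
    unfolding mean_range_def by (rule expectation_cong_pmf, rule card_step)
  also have "\<dots> = measure_pmf.expectation (walk (Suc n) v) (\<lambda>r. real (card (set (tl (fst r)))))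
      + no_return_probability n v"
    unfolding no_return_probability_def using finite_walk[OF assms]
    by (intro Bochner_Integration.integral_add integrable_measure_pmf_finite)
  also have "measure_pmf.expectation (walk (Suc n) v) (\<lambda>r. real (card (set (tl (fst r))))) =
      measure_pmf.expectation (K v) (\<lambda>w. mean_range n w)"
    unfolding mean_range_def walk.simps
    using kernel_finite[OF assms] kernel_closed[OF assms] finite_walk
    by (subst expectation_bind_pmf_finite) (auto simp: case_prod_unfold)
  also have "\<dots> = measure_pmf.expectation (K v) (\<lambda>_. mean_range n v)"
    using kernel_closed[OF assms] mean_range_homogeneous[OF _ assms]
    by (intro expectation_cong_pmf) auto
  finally show ?thesis by simp
qed

lemma mean_range_eq_sum:
  "v \<in> V \<Longrightarrow> mean_range n v = (\<Sum>k<n. no_return_probability k v)"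
  by (induction n) (simp_all only: mean_range_Suc sum.lessThan_Suc, simp add: mean_range_def)

end

section \<open>Processes that follow a homogeneous kernel\<close>

locale homogeneous_walk = prob_space M + homogeneous_kernel V K
  for M :: "'w measure" and V :: "'a set" and K :: "'a \<Rightarrow> 'a pmf" +
  fixes e :: 'a and S :: "nat \<Rightarrow> 'w \<Rightarrow> 'a"
  assumes countable_states: "countable V"
    and start_state: "e \<in> V"
    and rv: "\<And>n. S n \<in> measurable M (count_space V)"
    and start: "AE \<omega> in M. S 0 \<omega> = e"
    and step: "\<And>n x. (\<And>i. x i \<in> V) \<Longrightarrow>
      \<P>(\<omega> in M. \<forall>i\<le>Suc n. S i \<omega> = x i) =
      \<P>(\<omega> in M. \<forall>i\<le>n. S i \<omega> = x i) * pmf (K (x n)) (x (Suc n))"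
begin

lemma rv_UNIV [measurable]: "S n \<in> measurable M (count_space UNIV)"
  using measurable_compose[OF rv, of "\<lambda>x. x" "count_space UNIV"] by simp

lemma prob_path:
  assumes "\<And>i. x i \<in> V"
  shows "\<P>(\<omega> in M. \<forall>i\<le>n. S i \<omega> = x i) = pmf (walk n e) (map x [0..<n], x n)"
proof (induction n)
  case 0
  show ?case
  proof (cases "x 0 = e")
    case True
    then have "\<P>(\<omega> in M. S 0 \<omega> = x 0) = 1"
      using start by (subst prob_Collect_eq_1) auto
    then show ?thesis using True by simp
  next
    case False
    then have "\<P>(\<omega> in M. S 0 \<omega> = x 0) = 0"
      using start by (subst prob_Collect_eq_0) auto
    then show ?thesis using False by simp
  qed
next
  case (Suc n)
  have "pmf (walk (Suc n) e) (map x [0..<n] @ [x n], x (Suc n)) =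
      pmf (walk n e) (map x [0..<n], x n) * pmf (K (x n)) (x (Suc n))"
    by (rule pmf_walk_Suc_snoc)
  then show ?case
    using step[OF assms, of n] Suc by (simp del: walk.simps(2))
qed

definition history :: "nat \<Rightarrow> 'w \<Rightarrow> 'a list \<times> 'a" where
  "history n \<omega> = (map (\<lambda>i. S i \<omega>) [0..<n], S n \<omega>)"

lemma history_eq_iff:
  assumes "length xs = n"
  shows "history n \<omega> = (xs, y) \<longleftrightarrow> (\<forall>i\<le>n. S i \<omega> = (if i < n then xs ! i else y))"
  using assms by (auto simp: history_def list_eq_iff_nth_eq le_less)

lemma history_vimage:
  assumes "length xs = n"
  shows "history n -` {(xs, y)} \<inter> space M =
    {\<omega> \<in> space M. \<forall>i\<le>n. S i \<omega> = (if i < n then xs ! i else y)}"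
  using history_eq_iff[OF assms] by blast

lemma history_in_V:
  "\<omega> \<in> space M \<Longrightarrow> history n \<omega> \<in> {xs. length xs = n \<and> set xs \<subseteq> V} \<times> V"
  using measurable_space[OF rv] by (auto simp: history_def)

lemma countable_histories: "countable ({xs. length xs = n \<and> set xs \<subseteq> V} \<times> V)"
proof -
  have "countable {xs. length xs = n \<and> set xs \<subseteq> V}"
    by (rule countable_subset[OF _ countable_lists[OF countable_states]]) (auto simp: in_lists_conv_set)
  then show ?thesis
    using countable_states by simp
qed

lemma measurable_history: "history n \<in> measurable M (count_space UNIV)"
proof (rule measurableI)
  let ?H = "{xs. length xs = n \<and> set xs \<subseteq> V} \<times> V"
  fix A
  have "history n -` {r} \<inter> space M \<in> sets M" if "r \<in> ?H" for r
  proof (cases r)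
    case (Pair xs y)
    then have "length xs = n" using that by simp
    show ?thesis
      unfolding Pair history_vimage[OF \<open>length xs = n\<close>] by measurable
  qed
  then have "(\<Union>r\<in>A \<inter> ?H. history n -` {r} \<inter> space M) \<in> sets M"
    by (intro sets.countable_UN'' countable_subset[OF _ countable_histories[of n]]) auto
  also have "(\<Union>r\<in>A \<inter> ?H. history n -` {r} \<inter> space M) = history n -` A \<inter> space M"
    using history_in_V[of _ n] by blast
  finally show "history n -` A \<inter> space M \<in> sets M" .
qed simp

text \<open>Since only countably many histories are possible, it suffices to compare the two laws on single
  histories, where both are products of transition probabilities.\<close>
lemma distr_history: "distr M (count_space UNIV) (history n) = measure_pmf (walk n e)"
proof (rule measure_eqI_countable_AE[OF _ _ _ _ countable_histories[of n]])
  let ?H = "{xs. length xs = n \<and> set xs \<subseteq> V} \<times> V"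
  show "AE r in distr M (count_space UNIV) (history n). r \<in> ?H"
    using history_in_V measurable_history by (subst AE_distr_iff) (auto intro!: AE_I2)
  show "AE r in measure_pmf (walk n e). r \<in> ?H"
    using set_pmf_walk[OF start_state] by (auto simp: AE_measure_pmf_iff)
  fix r assume "r \<in> ?H"
  then obtain xs y where r: "r = (xs, y)" "length xs = n" "set xs \<subseteq> V" "y \<in> V"
    by auto
  let ?x = "\<lambda>i. if i < n then xs ! i else y"
  have x: "?x i \<in> V" for i
    using r nth_mem by (auto simp: subset_iff)
  have "emeasure (distr M (count_space UNIV) (history n)) {r} =
      emeasure M (history n -` {r} \<inter> space M)"
    by (rule emeasure_distr[OF measurable_history]) simp
  also have "\<dots> = ennreal (\<P>(\<omega> in M. \<forall>i\<le>n. S i \<omega> = ?x i))"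
    unfolding r(1) history_vimage[OF r(2)] by (rule emeasure_eq_measure)
  also have "\<dots> = ennreal (pmf (walk n e) (map ?x [0..<n], ?x n))"
    by (subst prob_path[OF x]) simp
  also have "map ?x [0..<n] = xs"
    using r(2) by (auto intro: nth_equalityI)
  finally show "emeasure (distr M (count_space UNIV) (history n)) {r} =
      emeasure (measure_pmf (walk n e)) {r}"
    by (simp add: r(1) emeasure_pmf_single)
qed simp_all

lemma events_history: "{\<omega> \<in> space M. Q (history n \<omega>)} \<in> events"
  using measurable_sets[OF measurable_history, of "{r. Q r}" n] by (simp add: vimage_def Int_def conj_commute)

lemma prob_history:
  "\<P>(\<omega> in M. Q (history n \<omega>)) = measure_pmf.expectation (walk n e) (\<lambda>r. of_bool (Q r))"
proof -
  have "\<P>(\<omega> in M. Q (history n \<omega>)) = measure (distr M (count_space UNIV) (history n)) {r. Q r}"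
    by (subst measure_distr[OF measurable_history]) (auto simp: vimage_def Int_def conj_commute)
  also have "\<dots> = measure_pmf.expectation (walk n e) (indicator {r. Q r})"
    unfolding distr_history by simp
  also have "(indicator {r. Q r} :: _ \<Rightarrow> real) = (\<lambda>r. of_bool (Q r))"
    by (auto simp: fun_eq_iff)
  finally show ?thesis .
qed

lemma return_prob_eq: "return_prob M S e n = return_probability n e"
  using prob_history[of "\<lambda>r. snd r = e" n]
  by (simp add: return_prob_def return_probability_def history_def)

lemma walk_range_eq: "walk_range S n \<omega> = card (set (fst (history n \<omega>)))"
  by (simp add: walk_range_def history_def lessThan_atLeast0)

lemma no_return_probability_eq:
  "no_return_probability n e = \<P>(\<omega> in M. \<forall>k\<in>{1..n}. S k \<omega> \<noteq> e)"
proof -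
  have "tl [0..<Suc n] = [1..<Suc n]"
    by (simp add: tl_upt)
  then have "set (tl (fst (history (Suc n) \<omega>))) = (\<lambda>k. S k \<omega>) ` {1..n}" for \<omega>
    by (simp add: history_def map_tl[symmetric] atLeastLessThanSuc_atLeastAtMost del: upt_Suc)
  then have "e \<notin> set (tl (fst (history (Suc n) \<omega>))) \<longleftrightarrow> (\<forall>k\<in>{1..n}. S k \<omega> \<noteq> e)" for \<omega>
    by auto
  then show ?thesis
    using prob_history[of "\<lambda>r. e \<notin> set (tl (fst r))" "Suc n"]
    by (simp add: no_return_probability_def del: walk.simps)
qed

lemma no_return_probability_antimono:
  "m \<le> n \<Longrightarrow> no_return_probability n e \<le> no_return_probability m e"
  unfolding no_return_probability_eq by (intro finite_measure_mono) auto

lemma sum_first_return_prob: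
  "(\<Sum>k<n. first_return_prob M S e (Suc k)) = 1 - no_return_probability n e"
proof (induction n)
  case 0
  then show ?case by (simp add: no_return_probability_eq prob_space)
next
  case (Suc n)
  have "{1..n} = {1..<Suc n}" by auto
  then have "{\<omega> \<in> space M. \<forall>k\<in>{1..n}. S k \<omega> \<noteq> e} = {\<omega> \<in> space M. \<forall>k\<in>{1..Suc n}. S k \<omega> \<noteq> e} \<union>
      {\<omega> \<in> space M. (\<forall>k\<in>{1..<Suc n}. S k \<omega> \<noteq> e) \<and> S (Suc n) \<omega> = e}"
    by (auto simp: le_Suc_eq less_Suc_eq_le)
  then have "no_return_probability n e =
      prob ({\<omega> \<in> space M. \<forall>k\<in>{1..Suc n}. S k \<omega> \<noteq> e} \<union>
      {\<omega> \<in> space M. (\<forall>k\<in>{1..<Suc n}. S k \<omega> \<noteq> e) \<and> S (Suc n) \<omega> = e})"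
    by (simp only: no_return_probability_eq)
  also have "\<dots> = no_return_probability (Suc n) e + first_return_prob M S e (Suc n)"
    unfolding no_return_probability_eq first_return_prob_def
    by (rule finite_measure_Union) auto
  finally show ?case
    using Suc by simp
qed

text \<open>The first return times are disjoint events, so \<open>f\<^sub>1 + \<dots> + f\<^sub>n\<close> is the probability of a return
  within \<open>n\<close> steps.\<close>
lemma no_return_probability_tendsto:
  "(\<lambda>n. no_return_probability n e) \<longlonglongrightarrow> 1 - total_return_prob M S e"
proof -
  have nonneg: "no_return_probability n e \<ge> 0" for n
    by (simp add: no_return_probability_eq)
  have "summable (\<lambda>n. first_return_prob M S e (Suc n))"
  proof (rule summableI_nonneg_bounded[where x = 1])
    show "(\<Sum>k<n. first_return_prob M S e (Suc k)) \<le> 1" for n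
      using nonneg[of n] by (simp add: sum_first_return_prob)
  qed (simp add: first_return_prob_def)
  from summable_LIMSEQ[OF this]
  have "(\<lambda>n. 1 - no_return_probability n e) \<longlonglongrightarrow> total_return_prob M S e"
    by (simp only: sum_first_return_prob total_return_prob_def)
  from tendsto_diff[OF tendsto_const[of 1] this] show ?thesis
    by simp
qed

lemma total_return_prob_le_1: "total_return_prob M S e \<le> 1"
proof -
  have "0 \<le> 1 - total_return_prob M S e"
    by (rule LIMSEQ_le_const[OF no_return_probability_tendsto]) (simp add: no_return_probability_eq)
  then show ?thesis by simp
qed

lemma total_return_prob_recurrent:
  assumes "recurrent M S e"
  shows "total_return_prob M S e = 1"
proof -
  have "(\<lambda>n. no_return_probability n e) \<longlonglongrightarrow>
      prob (\<Inter>n. {\<omega> \<in> space M. \<forall>k\<in>{1..n}. S k \<omega> \<noteq> e})"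
    unfolding no_return_probability_eq
    by (rule finite_Lim_measure_decseq) (auto simp: decseq_def)
  also have "(\<Inter>n. {\<omega> \<in> space M. \<forall>k\<in>{1..n}. S k \<omega> \<noteq> e}) =
      {\<omega> \<in> space M. \<forall>k\<ge>1. S k \<omega> \<noteq> e}"
    by (auto simp: Ball_def)
  also have "prob \<dots> = 0"
    using assms unfolding recurrent_def by (subst prob_Collect_eq_0) (auto elim!: eventually_mono)
  finally show ?thesis
    using LIMSEQ_unique[OF no_return_probability_tendsto] by force
qed

text \<open>This bounds the first \<open>m\<close> no-return probabilities by \<open>1\<close> and all later ones by that at \<open>m\<close>.
  Choosing \<open>m\<close> first and then \<open>L\<close> much larger makes \<open>E[R\<^sub>L] / L\<close> close to \<open>1 - F\<close>.\<close>
lemma mean_range_le: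
  "mean_range L e \<le> real m + real L * no_return_probability m e"
proof -
  have le_1: "no_return_probability k e \<le> 1" and nonneg: "no_return_probability k e \<ge> 0" for k
    by (simp_all add: no_return_probability_eq)
  have "mean_range L e \<le> (\<Sum>k<L. of_bool (k < m) + no_return_probability m e)"
    unfolding mean_range_eq_sum[OF start_state]
    using le_1 nonneg no_return_probability_antimono by (intro sum_mono) (auto simp: add_increasing2)
  also have "\<dots> = real (card ({..<L} \<inter> {..<m})) + real L * no_return_probability m e"
    by (simp add: sum.distrib Int_def lessThan_def)
  also have "card ({..<L} \<inter> {..<m}) \<le> m"
    using card_mono[of "{..<m}" "{..<L} \<inter> {..<m}"] by simp
  finally show ?thesis by simp
qed

lemma chernoff_range:
  assumes "t \<ge> 0"
  shows "\<P>(\<omega> in M. real (walk_range S n \<omega>) > x) \<le> range_mgf t n e * exp (- (t * x))"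
proof -
  have "\<P>(\<omega> in M. real (walk_range S n \<omega>) > x) =
      measure_pmf.expectation (walk n e) (\<lambda>r. of_bool (real (card (set (fst r))) > x))"
    unfolding walk_range_eq by (rule prob_history[of "\<lambda>r. real (card (set (fst r))) > x"])
  also have "\<dots> \<le> measure_pmf.expectation (walk n e)
      (\<lambda>r. exp (t * real (card (set (fst r)))) * exp (- (t * x)))"
    using assms
    by (intro expectation_mono_pmf_finite finite_walk start_state)
      (simp add: exp_add[symmetric] mult_left_mono)
  finally show ?thesis
    by (simp add: range_mgf_def)
qed

section \<open>Large ranges are exponentially unlikely\<close>

text \<open>Fix a block length \<open>L\<close> with \<open>a = E[R\<^sub>L] / L \<le> c + \<epsilon>/2\<close>, where \<open>c = 1 - F\<close>.  Cutting the path into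
  blocks of length \<open>L\<close> bounds \<open>E[exp (t R\<^sub>n / L)]\<close> by \<open>exp ((exp t - 1) a n / L)\<close>, up to a constant for
  the incomplete last block.  In Markov's inequality this competes with \<open>exp (- t (c + \<epsilon>) n / L)\<close>,
  and the latter wins for small \<open>t\<close> because \<open>exp t - 1\<close> is \<open>t\<close> to first order.\<close>
lemma range_large_deviation:
  assumes "\<epsilon> > 0"
  obtains C \<kappa> where "C > 0" "\<kappa> > 0"
    "\<And>n. \<P>(\<omega> in M. real (walk_range S n \<omega>) > real n * (1 - total_return_prob M S e + \<epsilon>))
      \<le> C * exp (- (\<kappa> * real n))"
proof -
  define c where "c = 1 - total_return_prob M S e"
  have "c \<ge> 0"
    using total_return_prob_le_1 by (simp add: c_def)
  have "eventually (\<lambda>m. no_return_probability m e < c + \<epsilon> / 4) sequentially"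
    using no_return_probability_tendsto \<open>\<epsilon> > 0\<close> unfolding c_def
    by (intro order_tendstoD) auto
  then obtain m where m: "no_return_probability m e < c + \<epsilon> / 4"
    unfolding eventually_sequentially by blast
  obtain L' :: nat where "real L' > 4 * real m / \<epsilon>"
    using reals_Archimedean2 by blast
  define L where "L = Suc L'"
  have "L > 0" and L: "real m / real L \<le> \<epsilon> / 4"
    using \<open>real L' > 4 * real m / \<epsilon>\<close> \<open>\<epsilon> > 0\<close> by (auto simp: L_def field_simps)
  define a where "a = mean_range L e / real L"
  have "a \<le> real m / real L + no_return_probability m e"
    using mean_range_le[of L m] \<open>L > 0\<close> by (simp add: a_def field_simps)
  then have a_le: "a \<le> c + \<epsilon> / 2"
    using m L by linarith
  have "a \<le> 1"
    using mean_range_le[of L 0] \<open>L > 0\<close> by (simp add: a_def no_return_probability_eq prob_space field_simps)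
  have "a \<ge> 0"
    unfolding a_def mean_range_def by (intro divide_nonneg_nonneg Bochner_Integration.integral_nonneg) auto
  \<comment> \<open>\<open>t \<le> 1\<close> makes \<open>exp t - 1 \<le> t + t\<^sup>2\<close> available, and \<open>t \<le> \<epsilon> / 4\<close> makes the quadratic error at most
    half of the gain \<open>t \<epsilon> / 2\<close>; the other half, \<open>t \<epsilon> / 4\<close>, becomes the exponential rate.\<close>
  define t where "t = min 1 (\<epsilon> / 4)"
  have t: "t > 0" "t \<le> 1" "t \<le> \<epsilon> / 4"
    using \<open>\<epsilon> > 0\<close> by (auto simp: t_def)
  define B where "B = t * (c + \<epsilon>) - t * \<epsilon> / 4"
  have "B \<ge> 0"
    using t \<open>c \<ge> 0\<close> \<open>\<epsilon> > 0\<close> by (simp add: B_def algebra_simps)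
  have "(exp t - 1) * a \<le> (t + t\<^sup>2) * a"
    using exp_bound[of t] t \<open>a \<ge> 0\<close> by (intro mult_right_mono) auto
  also have "\<dots> \<le> t * (c + \<epsilon> / 2) + t * (\<epsilon> / 4) * 1"
    unfolding distrib_right power2_eq_square
    using t a_le \<open>a \<le> 1\<close> \<open>a \<ge> 0\<close> \<open>\<epsilon> > 0\<close> by (intro add_mono mult_mono mult_left_mono) auto
  also have "\<dots> = B"
    by (simp add: B_def algebra_simps)
  finally have mean_bound: "(exp t - 1) * a \<le> B" .
  have mgf: "range_mgf (t / real L) n e \<le> exp (B * (real n / real L) + t)" for n
  proof -
    let ?k = "n div L" and ?r = "n mod L"
    have "range_mgf (t / real L) n e = range_mgf (t / real L) (L * ?k + ?r) e"
      by simp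
    also have "\<dots> \<le> range_mgf (t / real L) (L * ?k) e * range_mgf (t / real L) ?r e"
      using t start_state by (intro range_mgf_submult) auto
    also have "\<dots> \<le> range_mgf (t / real L) L e ^ ?k * exp (t / real L * real ?r)"
      using t start_state range_mgf_nonneg
      by (intro mult_mono range_mgf_mult_le_power range_mgf_le_exp zero_le_power) auto
    also have "\<dots> \<le> exp B ^ ?k * exp t"
    proof (intro mult_mono power_mono)
      show "range_mgf (t / real L) L e \<le> exp B"
        using range_mgf_le_mean_range[OF start_state \<open>L > 0\<close>, of t] mean_bound
        by (simp add: a_def order_trans)
      show "exp (t / real L * real ?r) \<le> exp t"
        using t \<open>L > 0\<close> less_imp_le[OF mod_less_divisor[OF \<open>L > 0\<close>, of n]]
        by (simp add: field_simps)
    qed (use range_mgf_nonneg in auto)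
    also have "\<dots> = exp (B * real ?k + t)"
      by (simp add: exp_add exp_of_nat_mult[symmetric] mult.commute)
    also have "\<dots> \<le> exp (B * (real n / real L) + t)"
      using mult_left_mono[OF of_nat_div_le_of_nat[of n L] \<open>B \<ge> 0\<close>] by simp
    finally show ?thesis .
  qed
  have "\<P>(\<omega> in M. real (walk_range S n \<omega>) > real n * (c + \<epsilon>))
      \<le> exp t * exp (- (t * \<epsilon> / (4 * real L) * real n))" for n
  proof -
    have "\<P>(\<omega> in M. real (walk_range S n \<omega>) > real n * (c + \<epsilon>))
        \<le> range_mgf (t / real L) n e * exp (- (t / real L * (real n * (c + \<epsilon>))))"
      using t by (intro chernoff_range) simp
    also have "\<dots> \<le> exp (B * (real n / real L) + t) * exp (- (t / real L * (real n * (c + \<epsilon>))))"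
      using mgf by (intro mult_right_mono) auto
    also have "\<dots> = exp t * exp (- (t * \<epsilon> / (4 * real L) * real n))"
      unfolding exp_add[symmetric] using \<open>L > 0\<close> by (simp add: B_def field_simps)
    finally show ?thesis .
  qed
  moreover have "t * \<epsilon> / (4 * real L) > 0"
    using t \<open>\<epsilon> > 0\<close> \<open>L > 0\<close> by simp
  ultimately show thesis
    using that[of "exp t" "t * \<epsilon> / (4 * real L)"] unfolding c_def by simp
qed

end

section \<open>Subexponential decay of the return probabilities\<close>

lemma eventually_multiples_at_top:
  "eventually P (multiples_at_top p) \<longleftrightarrow> (\<forall>\<^sub>F n in at_top. p dvd n \<longrightarrow> P n)"
  by (simp add: multiples_at_top_def eventually_inf_principal)

text \<open>The assumption on the limit superior provides one \<open>m\<close> with \<open>u\<^sub>2\<^sub>m\<close> at least \<open>exp (- 2 \<kappa> m)\<close>.  An even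
  \<open>n\<close> is reached by steps of length \<open>2 m\<close> followed by fewer than \<open>m\<close> steps of length \<open>2\<close>, which cost
  only a constant.  An odd \<open>n\<close> is a multiple of the greatest common divisor only if some odd \<open>k\<close> has
  \<open>u\<^sub>k > 0\<close>, and then \<open>n - k\<close> is even.\<close>
lemma supermultiplicative_subexponential:
  fixes u :: "nat \<Rightarrow> real"
  assumes nonneg: "\<And>n. u n \<ge> 0" and le_1: "\<And>n. u n \<le> 1" and u_0: "u 0 = 1"
    and supermult: "\<And>m n. u m * u n \<le> u (m + n)"
    and u_2: "u 2 > 0"
    and limsup: "limsup (\<lambda>n. ereal (u (2 * n) powr (1 / real n))) = 1"
    and "\<kappa> > 0"
  obtains C where "C > 0"
    "\<forall>\<^sub>F n in multiples_at_top (Gcd {n. n \<ge> 1 \<and> u n > 0}). C * exp (- (\<kappa> * real n)) \<le> u n"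
proof -
  have u_power: "u m ^ k \<le> u (k * m)" for m k
  proof (induction k)
    case (Suc k)
    then have "u m * u m ^ k \<le> u m * u (k * m)"
      using nonneg by (intro mult_left_mono)
    then show ?case
      using supermult[of m "k * m"] by simp
  qed (simp add: u_0)
  \<comment> \<open>The index \<open>0\<close> is of no use, since there the exponent \<open>1 / 0\<close> is \<open>0\<close>.\<close>
  have "\<exists>m\<ge>1. u (2 * m) powr (1 / real m) > exp (- (2 * \<kappa>))"
  proof (rule ccontr)
    assume "\<not> ?thesis"
    then have "\<forall>\<^sub>F n in sequentially. ereal (u (2 * n) powr (1 / real n)) \<le> ereal (exp (- (2 * \<kappa>)))"
      by (intro eventually_sequentiallyI[of 1]) (auto simp: not_less)
    then have "limsup (\<lambda>n. ereal (u (2 * n) powr (1 / real n))) \<le> ereal (exp (- (2 * \<kappa>)))"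
      by (rule Limsup_bounded)
    then show False
      using limsup \<open>\<kappa> > 0\<close> by (simp add: one_ereal_def)
  qed
  then obtain m where m: "m \<ge> 1" "u (2 * m) powr (1 / real m) > exp (- (2 * \<kappa>))"
    by blast
  have "exp (- (2 * \<kappa>)) powr real m < (u (2 * m) powr (1 / real m)) powr real m"
    using m by (intro powr_less_mono2) auto
  then have u_2m: "exp (- (\<kappa> * real (2 * m))) \<le> u (2 * m)"
    using m(1) nonneg by (simp add: powr_powr exp_powr_real mult_ac)
  have even: "u 2 ^ m * exp (- (\<kappa> * real n)) \<le> u n" if "even n" for n
  proof -
    define q r where "q = n div (2 * m)" and "r = n mod (2 * m) div 2"
    have "even (n mod (2 * m))"
      using that by (simp add: dvd_mod)
    then have "r * 2 = n mod (2 * m)"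
      by (simp add: r_def)
    then have n: "n = q * (2 * m) + r * 2"
      unfolding q_def by (simp only: div_mult_mod_eq)
    have "n mod (2 * m) < 2 * m"
      using m(1) by simp
    then have "r \<le> m"
      unfolding r_def by linarith
    have "exp (- (\<kappa> * real n)) \<le> exp (- (\<kappa> * real (q * (2 * m))))"
      using \<open>\<kappa> > 0\<close> n by (simp add: mult_left_mono)
    also have "\<dots> = exp (- (\<kappa> * real (2 * m))) ^ q"
      by (simp add: exp_of_nat_mult[symmetric] mult_ac)
    also have "\<dots> \<le> u (2 * m) ^ q"
      using u_2m by (intro power_mono) auto
    also have "\<dots> \<le> u (q * (2 * m))"
      by (rule u_power)
    finally have "u 2 ^ m * exp (- (\<kappa> * real n)) \<le> u 2 ^ r * u (q * (2 * m))"
      using \<open>r \<le> m\<close> le_1 nonneg by (intro mult_mono power_decreasing) auto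
    also have "\<dots> \<le> u (r * 2) * u (q * (2 * m))"
      using u_power nonneg by (intro mult_right_mono)
    also have "\<dots> \<le> u n"
      using supermult[of "r * 2" "q * (2 * m)"] n by (simp add: add.commute)
    finally show ?thesis .
  qed
  show thesis
  proof (cases "\<exists>k. odd k \<and> u k > 0")
    case True
    then obtain k where k: "odd k" "u k > 0" by blast
    define C where "C = u k * u 2 ^ m"
    have "C * exp (- (\<kappa> * real n)) \<le> u n" if "n \<ge> k" for n
    proof (cases "even n")
      case True
      have "C * exp (- (\<kappa> * real n)) \<le> 1 * u 2 ^ m * exp (- (\<kappa> * real n))"
        unfolding C_def using le_1 nonneg by (intro mult_right_mono) auto
      also have "\<dots> \<le> u n"
        using even[OF True] by simp
      finally show ?thesis .
    next
      case False
      then have "even (n - k)"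
        using k(1) that by simp
      have "C * exp (- (\<kappa> * real n)) \<le> C * exp (- (\<kappa> * real (n - k)))"
        unfolding C_def using nonneg \<open>\<kappa> > 0\<close> by (intro mult_left_mono) (auto simp: mult_left_mono)
      also have "\<dots> \<le> u k * u (n - k)"
        unfolding C_def using even[OF \<open>even (n - k)\<close>] nonneg by (simp add: mult.assoc mult_left_mono)
      also have "\<dots> \<le> u n"
        using supermult[of k "n - k"] that by simp
      finally show ?thesis .
    qed
    moreover have "C > 0"
      using k u_2 by (simp add: C_def)
    ultimately show thesis
      using that[of C] unfolding eventually_multiples_at_top eventually_sequentially by blast
  next
    case False
    then have "2 dvd Gcd {n. n \<ge> 1 \<and> u n > 0}"
      by (intro Gcd_greatest) auto
    then have "Gcd {n. n \<ge> 1 \<and> u n > 0} dvd n \<longrightarrow> u 2 ^ m * exp (- (\<kappa> * real n)) \<le> u n" for n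
      using even dvd_trans by blast
    then show thesis
      using that[of "u 2 ^ m"] u_2 unfolding eventually_multiples_at_top by simp
  qed
qed

section \<open>The range conditioned on a return\<close>

context homogeneous_walk
begin

text \<open>The large deviation bound decays at some rate \<open>\<kappa>\<close>; the return probabilities are eventually at
  least a constant times \<open>exp (- \<kappa> n / 2)\<close>, so the quotient still decays at rate \<open>\<kappa> / 2\<close>.\<close>
lemma conditional_range_tendsto:
  assumes limsup: "limsup (\<lambda>n. ereal (return_prob M S e (2 * n) powr (1 / real n))) = 1"
    and "\<epsilon> > 0"
  shows "((\<lambda>n. \<P>(\<omega> in M. real (walk_range S n \<omega>) / real n > 1 - total_return_prob M S e + \<epsilon>
      \<bar> S n \<omega> = e)) \<longlongrightarrow> 0) (multiples_at_top (period M S e))"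
proof -
  let ?u = "return_prob M S e"
  let ?c = "1 - total_return_prob M S e + \<epsilon>"
  obtain C \<kappa> where C: "C > 0" "\<kappa> > 0"
    "\<And>n. \<P>(\<omega> in M. real (walk_range S n \<omega>) > real n * ?c) \<le> C * exp (- (\<kappa> * real n))"
    using range_large_deviation[OF \<open>\<epsilon> > 0\<close>] by metis
  obtain C' where C': "C' > 0"
    "\<forall>\<^sub>F n in multiples_at_top (period M S e). C' * exp (- (\<kappa> / 2 * real n)) \<le> ?u n"
    unfolding period_def
  proof (rule supermultiplicative_subexponential[of ?u "\<kappa> / 2"])
    show "?u 0 = 1"
      by (simp add: return_prob_eq return_probability_def)
    show "?u m * ?u n \<le> ?u (m + n)" for m n
      unfolding return_prob_eq by (rule return_probability_supermult[OF start_state])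
    show "?u 2 > 0"
      unfolding return_prob_eq by (rule return_probability_2_pos[OF start_state])
    show "?u n \<ge> 0" "?u n \<le> 1" for n
      by (simp_all add: return_prob_def)
  qed (use limsup C(2) in auto)
  have "\<forall>\<^sub>F n in multiples_at_top (period M S e). n \<ge> 1"
    unfolding eventually_multiples_at_top by (auto intro: eventually_mono[OF eventually_ge_at_top])
  with C'(2) have upper: "\<forall>\<^sub>F n in multiples_at_top (period M S e).
      \<P>(\<omega> in M. real (walk_range S n \<omega>) / real n > ?c \<bar> S n \<omega> = e)
        \<le> C / C' * exp (- (\<kappa> / 2 * real n))"
  proof eventually_elim
    case (elim n)
    let ?E = "exp (- (\<kappa> / 2 * real n))"
    have E: "exp (- (\<kappa> * real n)) = ?E * ?E"
      by (simp add: exp_add[symmetric])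
    have "\<P>(\<omega> in M. real (walk_range S n \<omega>) / real n > ?c \<and> S n \<omega> = e) \<le>
        \<P>(\<omega> in M. real (walk_range S n \<omega>) > real n * ?c)"
      unfolding walk_range_eq using elim(2)
      by (intro finite_measure_mono events_history[of "\<lambda>r. real (card (set (fst r))) > real n * ?c" n])
        (auto simp: pos_less_divide_eq mult.commute)
    also have "\<dots> \<le> C * (?E * ?E)"
      using C(3)[of n] by (simp add: E)
    also have "\<dots> = C / C' * ?E * (C' * ?E)"
      using C'(1) by simp
    also have "\<dots> \<le> C / C' * ?E * ?u n"
      using C C'(1) elim(1) by (intro mult_left_mono) auto
    finally have "\<P>(\<omega> in M. real (walk_range S n \<omega>) / real n > ?c \<and> S n \<omega> = e) \<le> C / C' * ?E * ?u n" .
    moreover have "0 < C' * ?E"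
      using C'(1) by simp
    then have "?u n > 0"
      using elim(1) by linarith
    ultimately show ?case
      unfolding cond_prob_def return_prob_def by (simp add: pos_divide_le_eq)
  qed
  have limit: "((\<lambda>n. C / C' * exp (- (\<kappa> / 2 * real n))) \<longlongrightarrow> 0) (multiples_at_top (period M S e))"
  proof -
    have "(\<lambda>n. C / C' * exp (- (\<kappa> / 2)) ^ n) \<longlonglongrightarrow> 0"
      using C(2) by (intro tendsto_mult_right_zero LIMSEQ_realpow_zero) auto
    then have "(\<lambda>n. C / C' * exp (- (\<kappa> / 2 * real n))) \<longlonglongrightarrow> 0"
      by (simp add: exp_of_nat_mult[symmetric] mult_ac)
    then show ?thesis
      unfolding multiples_at_top_def by (rule tendsto_mono[OF inf_le1])
  qed
  have "0 \<le> \<P>(\<omega> in M. real (walk_range S n \<omega>) / real n > ?c \<bar> S n \<omega> = e)" for n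
    by (simp add: cond_prob_def)
  then show ?thesis
    by (intro tendsto_sandwich[OF always_eventually upper tendsto_const limit] allI)
qed

end

section \<open>Simple random walk on a vertex transitive graph\<close>

context simple_random_walk
begin

lemma neighbors_nonempty:
  assumes "v \<in> V"
  shows "E `` {v} \<noteq> {}"
proof -
  have "infinite (V - {v})"
    using countably_infinite(2) by simp
  then obtain w where "w \<in> V" "w \<noteq> v"
    by (metis Diff_iff finite.emptyI ex_in_conv singletonI)
  from connected[OF assms \<open>w \<in> V\<close>] show ?thesis
    by (cases rule: converse_rtranclE) (use \<open>w \<noteq> v\<close> in auto)
qed

lemma pmf_neighbors:
  assumes "v \<in> V"
  shows "pmf (pmf_of_set (E `` {v})) w = (if (v, w) \<in> E then 1 / real D else 0)"
  using neighbors_nonempty[OF assms] degree[OF assms] by (simp add: indicator_def)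

lemma automorphism_neighbors:
  assumes "graph_automorphism V E \<phi>" "v \<in> V"
  shows "E `` {\<phi> v} = \<phi> ` (E `` {v})"
proof -
  have bij: "bij_betw \<phi> V V" and edge: "\<And>v w. v \<in> V \<Longrightarrow> w \<in> V \<Longrightarrow> (\<phi> v, \<phi> w) \<in> E \<longleftrightarrow> (v, w) \<in> E"
    using assms(1) by (auto simp: graph_automorphism_def)
  show ?thesis
  proof (intro equalityI subsetI)
    fix w assume w: "w \<in> E `` {\<phi> v}"
    then have "w \<in> \<phi> ` V"
      using edges(1) bij_betw_imp_surj_on[OF bij] by blast
    then show "w \<in> \<phi> ` (E `` {v})"
      using w edge[OF assms(2)] by auto
  next
    fix w assume "w \<in> \<phi> ` (E `` {v})"
    then show "w \<in> E `` {\<phi> v}"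
      using edges(1) edge[OF assms(2)] by auto
  qed
qed

lemma graph_homogeneous_walk: "homogeneous_walk M V (\<lambda>v. pmf_of_set (E `` {v})) e S"
proof unfold_locales
  fix v assume v: "v \<in> V"
  show "set_pmf (pmf_of_set (E `` {v})) \<subseteq> V" "finite (set_pmf (pmf_of_set (E `` {v})))"
    using neighbors_nonempty[OF v] degree(1)[OF v] edges(1) by auto
  fix w assume w: "w \<in> V"
  show "pmf (pmf_of_set (E `` {v})) w = pmf (pmf_of_set (E `` {w})) v"
    using symD[OF edges(2)] by (auto simp: pmf_neighbors[OF v] pmf_neighbors[OF w])
  obtain \<phi> where \<phi>: "graph_automorphism V E \<phi>" "\<phi> v = w"
    using transitive[OF v w] by blast
  then have bij: "bij_betw \<phi> V V"
    by (simp add: graph_automorphism_def)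
  have "pmf_of_set (E `` {\<phi> u}) = map_pmf \<phi> (pmf_of_set (E `` {u}))" if "u \<in> V" for u
  proof -
    have "E `` {u} \<subseteq> V"
      using edges(1) by auto
    then show ?thesis
      using neighbors_nonempty[OF that] degree(1)[OF that] bij
      by (subst map_pmf_of_set_inj)
        (auto simp: automorphism_neighbors[OF \<phi>(1) that] bij_betw_def intro: inj_on_subset)
  qed
  with bij \<phi>(2) show "\<exists>\<phi>. bij_betw \<phi> V V \<and> \<phi> v = w \<and>
      (\<forall>u\<in>V. pmf_of_set (E `` {\<phi> u}) = map_pmf \<phi> (pmf_of_set (E `` {u})))"
    by blast
next
  fix n and x :: "nat \<Rightarrow> 'a" assume x: "\<And>i. x i \<in> V"
  let ?past = "\<P>(\<omega> in M. \<forall>i\<le>n. S i \<omega> = x i)"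
  let ?now = "\<P>(\<omega> in M. \<forall>i\<le>Suc n. S i \<omega> = x i)"
  have [measurable]: "S i \<in> measurable M (count_space UNIV)" for i
    using measurable_compose[OF rv, of "\<lambda>x. x" "count_space UNIV"] by simp
  have now: "?now = \<P>(\<omega> in M. S (Suc n) \<omega> = x (Suc n) \<and> (\<forall>i\<le>n. S i \<omega> = x i))"
    by (rule arg_cong[where f = prob]) (auto simp: le_Suc_eq)
  show "?now = ?past * pmf (pmf_of_set (E `` {x n})) (x (Suc n))"
    \<comment> \<open>Transition probabilities are specified only after histories of positive probability; after a
      null history both sides vanish.\<close>
  proof (cases "?past > 0")
    case True
    show ?thesis
      using markov[OF x True, of "Suc n"] True unfolding pmf_neighbors[OF x] now cond_prob_def
      by (simp only: divide_eq_eq mult.commute split: if_splits)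
  next
    case False
    moreover have "?now \<le> ?past"
      by (intro finite_measure_mono) auto
    ultimately show ?thesis
      by (simp add: not_less measure_le_0_iff)
  qed
qed (use countably_infinite start_in rv start in auto)

end

section \<open>Symmetric random walk on a finitely generated group\<close>

context group_random_walk
begin

text \<open>Every element is the product of a finite word in the generators and their inverses.\<close>
lemma countable_carrier: "countable (carrier G)"
proof -
  define H where "H = g ` {1..s} \<union> (\<lambda>i. inv (g i)) ` {1..s}"
  define W where "W = lists (H \<union> m_inv G ` H)"
  have H: "H \<union> m_inv G ` H \<subseteq> carrier G"
    using generators(1) by (auto simp: H_def)
  have closed: "foldr (\<otimes>) xs \<one> \<in> carrier G" if "xs \<in> W" for xs
    using that H unfolding W_def by (induction xs) auto
  have append: "foldr (\<otimes>) (xs @ ys) \<one> = foldr (\<otimes>) xs \<one> \<otimes> foldr (\<otimes>) ys \<one>"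
    if "xs \<in> W" "ys \<in> W" for xs ys
    using that(1) unfolding W_def
  proof (induction xs)
    case Nil
    then show ?case using closed[OF that(2)] by simp
  next
    case (Cons x xs)
    then have "x \<in> carrier G" "foldr (\<otimes>) xs \<one> \<in> carrier G" "foldr (\<otimes>) ys \<one> \<in> carrier G"
      using H closed[OF that(2)] closed[of xs] by (auto simp: W_def)
    then show ?case
      using Cons.IH by (simp add: m_assoc)
  qed
  have "x \<in> (\<lambda>xs. foldr (\<otimes>) xs \<one>) ` W" if "x \<in> generate G H" for x
    using that
  proof induction
    case one
    show ?case by (rule image_eqI[of _ _ "[]"]) (auto simp: W_def)
  next
    case (incl h)
    then show ?case using H by (intro image_eqI[of _ _ "[h]"]) (auto simp: W_def)
  next
    case (inv h)
    then show ?case using H by (intro image_eqI[of _ _ "[inv h]"]) (auto simp: W_def)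
  next
    case (eng h1 h2)
    then obtain xs ys where "xs \<in> W" "ys \<in> W" "h1 = foldr (\<otimes>) xs \<one>" "h2 = foldr (\<otimes>) ys \<one>"
      by auto
    then show ?case
      using append[of xs ys] by (intro image_eqI[of _ _ "xs @ ys"]) (simp_all add: W_def del: foldr_append)
  qed
  moreover have "countable W"
    unfolding W_def H_def by (intro countable_lists) (auto intro: countable_finite)
  ultimately show ?thesis
    using generators(2) by (metis H_def countable_image countable_subset subsetI)
qed

lemma step_measurable: "k \<ge> 1 \<Longrightarrow> X k \<in> measurable M (count_space (carrier G))"
  using indep by (auto simp: indep_vars_def)

lemma step_in_carrier: "k \<ge> 1 \<Longrightarrow> \<omega> \<in> space M \<Longrightarrow> X k \<omega> \<in> carrier G"
  using measurable_space[OF step_measurable] by auto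

lemma walk_measurable: "S n \<in> measurable M (count_space (carrier G))"
proof (induction n)
  case 0
  have "S 0 \<in> measurable M (count_space (carrier G)) \<longleftrightarrow> (\<lambda>_. \<one>) \<in> measurable M (count_space (carrier G))"
    by (rule measurable_cong) (simp add: walk_0)
  then show ?case by simp
next
  case (Suc n)
  have "(\<lambda>\<omega>. S n \<omega> \<otimes> X (Suc n) \<omega>) \<in> measurable M (count_space (carrier G))"
  proof (rule measurable_compose_countable'[OF _ Suc countable_carrier])
    fix a assume "a \<in> carrier G"
    then show "(\<lambda>\<omega>. a \<otimes> X (Suc n) \<omega>) \<in> measurable M (count_space (carrier G))"
      by (intro measurable_compose[OF step_measurable]) auto
  qed
  then show ?case
    by (subst measurable_cong[OF walk_Suc])
qed

text \<open>A path determines its increments, which turns the law of a path into a product over the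
  independent steps.\<close>
lemma walk_path_iff:
  assumes "\<omega> \<in> space M" "\<And>i. x i \<in> carrier G"
  shows "(\<forall>i\<le>n. S i \<omega> = x i) \<longleftrightarrow> x 0 = \<one> \<and> (\<forall>i\<in>{1..n}. X i \<omega> = inv (x (i - 1)) \<otimes> x i)"
proof (induction n)
  case 0
  then show ?case using walk_0[OF assms(1)] by auto
next
  case (Suc n)
  have increment: "x n \<otimes> X (Suc n) \<omega> = x (Suc n) \<longleftrightarrow> X (Suc n) \<omega> = inv (x n) \<otimes> x (Suc n)"
    using inv_solve_left[OF step_in_carrier[OF _ assms(1)] assms(2) assms(2)] by (metis le_add1 plus_1_eq_Suc)
  have "(\<forall>i\<le>Suc n. S i \<omega> = x i) \<longleftrightarrow> (\<forall>i\<le>n. S i \<omega> = x i) \<and> x n \<otimes> X (Suc n) \<omega> = x (Suc n)"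
  proof -
    have "(\<forall>i\<le>Suc n. S i \<omega> = x i) \<longleftrightarrow> (\<forall>i\<le>n. S i \<omega> = x i) \<and> S (Suc n) \<omega> = x (Suc n)"
      by (auto simp: le_Suc_eq)
    then show ?thesis
      unfolding walk_Suc[OF assms(1)] by auto
  qed
  then show ?case
    unfolding Suc increment by (auto simp: atLeastAtMostSuc_conv)
qed

lemma prob_increments:
  assumes "\<And>i. y i \<in> carrier G"
  shows "\<P>(\<omega> in M. \<forall>i\<in>{1..n}. X i \<omega> = y i) = (\<Prod>i\<in>{1..n}. \<P>(\<omega> in M. X i \<omega> = y i))"
proof (cases "n = 0")
  case False
  have "{\<omega> \<in> space M. \<forall>i\<in>{1..n}. X i \<omega> = y i} = (\<Inter>i\<in>{1..n}. X i -` {y i} \<inter> space M)"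
    using False by auto
  also have "prob \<dots> = (\<Prod>i\<in>{1..n}. prob (X i -` {y i} \<inter> space M))"
    using False assms by (intro indep_varsD[OF indep]) auto
  finally show ?thesis
    by (simp add: vimage_def Int_def conj_commute)
qed (simp add: prob_space)

text \<open>The law of a step is symmetric because inversion interchanges the indices contributing through
  \<open>g i\<close> with those contributing through \<open>inv (g i)\<close>, and both carry the same weight.\<close>
lemma step_pmf_exists:
  "\<exists>\<mu> :: 'a pmf. set_pmf \<mu> \<subseteq> carrier G \<and> finite (set_pmf \<mu>) \<and>
    (\<forall>k\<ge>1. \<forall>x\<in>carrier G. \<P>(\<omega> in M. X k \<omega> = x) = pmf \<mu> x) \<and>
    (\<forall>x\<in>carrier G. pmf \<mu> (inv x) = pmf \<mu> x)"
proof -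
  define N where "N = distr M (count_space UNIV) (X 1)"
  have X1: "X 1 \<in> measurable M (count_space UNIV)"
    using measurable_compose[OF step_measurable[of 1], of "\<lambda>x. x" "count_space UNIV"] by simp
  interpret N: prob_space N
    unfolding N_def by (rule prob_space_distr[OF X1])
  have [simp]: "sets N = UNIV"
    by (simp add: N_def)
  have in_carrier: "AE x in N. x \<in> carrier G"
    using X1 step_in_carrier unfolding N_def by (subst AE_distr_iff) (auto intro!: AE_I2)
  then have "\<exists>A. countable A \<and> (AE x in N. x \<in> A)"
    using countable_carrier by blast
  then have "AE x in N. measure N {x} \<noteq> 0"
    using N.AE_support_countable by simp
  then have "measure_pmf (Abs_pmf N) = N"
    using N.prob_space_axioms by (intro Abs_pmf_inverse) simp
  then obtain \<mu> where \<mu>: "measure_pmf \<mu> = N"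
    by (rule that)
  have "AE x in measure_pmf \<mu>. x \<in> carrier G"
    unfolding \<mu> by (rule in_carrier)
  then have support: "set_pmf \<mu> \<subseteq> carrier G"
    by (auto simp: AE_measure_pmf_iff)
  have pmf: "pmf \<mu> x = \<P>(\<omega> in M. X 1 \<omega> = x)" for x
    unfolding measure_pmf_single[symmetric] \<mu> N_def
    by (subst measure_distr[OF X1]) (auto simp: vimage_def Int_def conj_commute)
  have law: "pmf \<mu> x =
      (\<Sum>i\<in>{i\<in>{1..s}. g i = x}. \<alpha> i) + (\<Sum>i\<in>{i\<in>{1..s}. inv (g i) = x}. \<alpha> (s + i))"
    if "x \<in> carrier G" for x
    unfolding pmf by (rule step_law) (use that in auto)
  have "x \<in> g ` {1..s} \<union> (\<lambda>i. inv (g i)) ` {1..s}" if "x \<in> set_pmf \<mu>" for x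
  proof (rule ccontr)
    assume "\<not> ?thesis"
    then have empty: "{i\<in>{1..s}. g i = x} = {}" "{i\<in>{1..s}. inv (g i) = x} = {}"
      by auto
    have "x \<in> carrier G"
      using support that by blast
    from law[OF this] have "pmf \<mu> x = 0"
      unfolding empty by simp
    then show False
      using that by (simp add: set_pmf_iff)
  qed
  then have "set_pmf \<mu> \<subseteq> g ` {1..s} \<union> (\<lambda>i. inv (g i)) ` {1..s}"
    by (rule subsetI)
  then have finite: "finite (set_pmf \<mu>)"
    by (rule finite_subset) simp
  have law_k: "\<P>(\<omega> in M. X k \<omega> = x) = pmf \<mu> x" if "k \<ge> 1" "x \<in> carrier G" for k x
    using step_law[OF that] law[OF that(2)] by simp
  have symmetric: "pmf \<mu> (inv x) = pmf \<mu> x" if "x \<in> carrier G" for x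
  proof -
    have g: "g i \<in> carrier G" if "i \<in> {1..s}" for i
      using generators(1) that by auto
    have "g i = inv x \<longleftrightarrow> inv (g i) = x" "inv (g i) = inv x \<longleftrightarrow> g i = x" if "i \<in> {1..s}" for i
      using g[OF that] \<open>x \<in> carrier G\<close> by (metis inv_inv)+
    then have "{i\<in>{1..s}. g i = inv x} = {i\<in>{1..s}. inv (g i) = x}"
      "{i\<in>{1..s}. inv (g i) = inv x} = {i\<in>{1..s}. g i = x}"
      by blast+
    moreover have "(\<Sum>i\<in>{i\<in>{1..s}. P i}. \<alpha> (s + i)) = (\<Sum>i\<in>{i\<in>{1..s}. P i}. \<alpha> i)" for P
      using weights(3) by (intro sum.cong) auto
    ultimately show ?thesis
      using that by (simp add: law)
  qed
  show ?thesis
    using support finite law_k symmetric by (intro exI[of _ \<mu>] conjI) simp_all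
qed

text \<open>A step multiplies on the right, hence left translations commute with it; the left translation by
  \<open>w \<otimes> inv v\<close> moves \<open>v\<close> to \<open>w\<close>.\<close>
lemma group_homogeneous_walk: "\<exists>K. homogeneous_walk M (carrier G) K \<one> S"
proof -
  obtain \<mu> :: "'a pmf" where \<mu>: "set_pmf \<mu> \<subseteq> carrier G" "finite (set_pmf \<mu>)"
    "\<forall>k\<ge>1. \<forall>x\<in>carrier G. \<P>(\<omega> in M. X k \<omega> = x) = pmf \<mu> x"
    "\<forall>x\<in>carrier G. pmf \<mu> (inv x) = pmf \<mu> x"
    using step_pmf_exists by (elim exE conjE)
  define K where "K v = map_pmf (\<lambda>x. v \<otimes> x) \<mu>" for v
  have pmf_K: "pmf (K v) w = pmf \<mu> (inv v \<otimes> w)" if "v \<in> carrier G" "w \<in> carrier G" for v w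
  proof -
    have "v \<otimes> x = w \<longleftrightarrow> x = inv v \<otimes> w" if "x \<in> set_pmf \<mu>" for x
      using inv_solve_left[OF subsetD[OF \<mu>(1) that] \<open>v \<in> carrier G\<close> \<open>w \<in> carrier G\<close>] by metis
    then have preimage: "(\<lambda>x. v \<otimes> x) -` {w} \<inter> set_pmf \<mu> = {inv v \<otimes> w} \<inter> set_pmf \<mu>"
      by blast
    have "pmf (K v) w = measure \<mu> ((\<lambda>x. v \<otimes> x) -` {w} \<inter> set_pmf \<mu>)"
      unfolding K_def pmf_map by (rule measure_Int_set_pmf[symmetric])
    also have "\<dots> = pmf \<mu> (inv v \<otimes> w)"
      unfolding preimage by (simp add: measure_Int_set_pmf measure_pmf_single)
    finally show ?thesis .
  qed
  have "homogeneous_walk M (carrier G) K \<one> S"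
  proof unfold_locales
    fix v assume v: "v \<in> carrier G"
    show "set_pmf (K v) \<subseteq> carrier G" "finite (set_pmf (K v))"
      using v \<mu>(1,2) by (auto simp: K_def)
    fix w assume w: "w \<in> carrier G"
    show "pmf (K v) w = pmf (K w) v"
      using v w bspec[OF \<mu>(4), of "inv v \<otimes> w"] by (simp add: pmf_K inv_mult_group)
    define a where "a = w \<otimes> inv v"
    have a: "a \<in> carrier G" "a \<otimes> v = w"
      using v w by (simp_all add: a_def m_assoc)
    have "bij_betw (\<lambda>u. a \<otimes> u) (carrier G) (carrier G)"
      using a(1) by (intro bij_betwI[of _ _ _ "\<lambda>u. inv a \<otimes> u"]) (auto simp: m_assoc[symmetric])
    moreover have "K (a \<otimes> u) = map_pmf (\<lambda>u. a \<otimes> u) (K u)" if "u \<in> carrier G" for u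
      unfolding K_def pmf.map_comp o_def
      by (intro map_pmf_cong refl m_assoc a(1) that subsetD[OF \<mu>(1)])
    ultimately show "\<exists>\<phi>. bij_betw \<phi> (carrier G) (carrier G) \<and> \<phi> v = w \<and>
        (\<forall>u\<in>carrier G. K (\<phi> u) = map_pmf \<phi> (K u))"
      using a(2) by (intro exI[of _ "\<lambda>u. a \<otimes> u"]) simp
  next
    fix n and x :: "nat \<Rightarrow> 'a" assume x: "\<And>i. x i \<in> carrier G"
    have path: "\<P>(\<omega> in M. \<forall>i\<le>n. S i \<omega> = x i) =
        of_bool (x 0 = \<one>) * (\<Prod>i\<in>{1..n}. pmf \<mu> (inv (x (i - 1)) \<otimes> x i))" for n
    proof -
      have y: "inv (x (i - 1)) \<otimes> x i \<in> carrier G" for i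
        using x by (intro m_closed inv_closed)
      have "{\<omega> \<in> space M. \<forall>i\<le>n. S i \<omega> = x i} =
          {\<omega> \<in> space M. x 0 = \<one> \<and> (\<forall>i\<in>{1..n}. X i \<omega> = inv (x (i - 1)) \<otimes> x i)}"
        by (rule Collect_cong, rule conj_cong[OF refl walk_path_iff[OF _ x]])
      then have "\<P>(\<omega> in M. \<forall>i\<le>n. S i \<omega> = x i) =
          \<P>(\<omega> in M. x 0 = \<one> \<and> (\<forall>i\<in>{1..n}. X i \<omega> = inv (x (i - 1)) \<otimes> x i))"
        by (rule arg_cong)
      also have "\<dots> =
          of_bool (x 0 = \<one>) * \<P>(\<omega> in M. \<forall>i\<in>{1..n}. X i \<omega> = inv (x (i - 1)) \<otimes> x i)"
        by (cases "x 0 = \<one>") simp_all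
      also have "\<P>(\<omega> in M. \<forall>i\<in>{1..n}. X i \<omega> = inv (x (i - 1)) \<otimes> x i) =
          (\<Prod>i\<in>{1..n}. \<P>(\<omega> in M. X i \<omega> = inv (x (i - 1)) \<otimes> x i))"
        by (rule prob_increments[OF y])
      also have "\<dots> = (\<Prod>i\<in>{1..n}. pmf \<mu> (inv (x (i - 1)) \<otimes> x i))"
        using \<mu>(3) y by (intro prod.cong refl) (simp only: atLeastAtMost_iff)
      finally show ?thesis .
    qed
    show "\<P>(\<omega> in M. \<forall>i\<le>Suc n. S i \<omega> = x i) =
        \<P>(\<omega> in M. \<forall>i\<le>n. S i \<omega> = x i) * pmf (K (x n)) (x (Suc n))"
      unfolding path pmf_K[OF x x] by (simp only: prod.nat_ivl_Suc' diff_Suc_1 mult_ac)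
  qed (use countable_carrier walk_measurable walk_0 in auto)
  then show ?thesis by blast
qed

end

section \<open>The range of the walk conditioned to return\<close>

theorem theorem1:
  fixes M :: "'w measure" and S :: "nat \<Rightarrow> 'w \<Rightarrow> 'a" and e :: 'a
    and V :: "'a set" and E :: "('a \<times> 'a) set" and D :: nat
    and G :: "('a, 'b) monoid_scheme" and s :: nat and g :: "nat \<Rightarrow> 'a"
    and \<alpha> :: "nat \<Rightarrow> real" and X :: "nat \<Rightarrow> 'w \<Rightarrow> 'a"
  assumes walk: "simple_random_walk M V E D e S \<or>
      (group_random_walk M G s g \<alpha> X S \<and> e = \<one>\<^bsub>G\<^esub>)"
    and limsup: "limsup (\<lambda>n. ereal (return_prob M S e (2 * n) powr (1 / real n))) = 1"
  shows "(\<forall>\<epsilon>>0. ((\<lambda>n. \<P>(\<omega> in M. real (walk_range S n \<omega>) / real n > 1 - total_return_prob M S e + \<epsilon>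
              \<bar> S n \<omega> = e))
            \<longlongrightarrow> 0) (multiples_at_top (period M S e))) \<and>
         (recurrent M S e \<longrightarrow>
           (\<forall>\<epsilon>>0. ((\<lambda>n. \<P>(\<omega> in M. real (walk_range S n \<omega>) / real n > \<epsilon> \<bar> S n \<omega> = e))
            \<longlongrightarrow> 0) (multiples_at_top (period M S e))))"
proof -
  have "\<exists>U K. homogeneous_walk M U K e S"
    using walk
  proof
    assume "simple_random_walk M V E D e S"
    then show ?thesis
      by (intro exI) (rule simple_random_walk.graph_homogeneous_walk)
  next
    assume "group_random_walk M G s g \<alpha> X S \<and> e = \<one>\<^bsub>G\<^esub>"
    then have "group_random_walk M G s g \<alpha> X S" "e = \<one>\<^bsub>G\<^esub>"
      by simp_all
    from group_random_walk.group_homogeneous_walk[OF this(1)] this(2) show ?thesis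
      by metis
  qed
  then obtain U K where "homogeneous_walk M U K e S"
    by blast
  then interpret homogeneous_walk M U K e S .
  show ?thesis
  proof (intro conjI allI impI)
    fix \<epsilon> :: real assume "\<epsilon> > 0"
    note bound = conditional_range_tendsto[OF limsup \<open>\<epsilon> > 0\<close>]
    show "((\<lambda>n. \<P>(\<omega> in M. real (walk_range S n \<omega>) / real n > 1 - total_return_prob M S e + \<epsilon>
        \<bar> S n \<omega> = e)) \<longlongrightarrow> 0) (multiples_at_top (period M S e))"
      by (rule bound)
    assume "recurrent M S e"
    from bound show "((\<lambda>n. \<P>(\<omega> in M. real (walk_range S n \<omega>) / real n > \<epsilon> \<bar> S n \<omega> = e))
        \<longlongrightarrow> 0) (multiples_at_top (period M S e))"
      unfolding total_return_prob_recurrent[OF \<open>recurrent M S e\<close>] by simp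
  qed
qed

end
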